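(* Let $(L,\cdot,\alpha)$ be a (left) Hom-Leibniz algebra over a field $\mathbb{K}$ of characteristic $0$, and let $x^n$ denote the $n$th (right) Hom-power of $x\in L$. Then: (i) $x^n = 0$ for all $n\ge 3$ and all $x\in L$; (ii) $(L,\cdot,\alpha)$ is Hom-power associative if and only if $\alpha(x)\cdot x^2 = 0$ for all $x\in L$.
   Context: A Hom-algebra is a triple $(A,\cdot,\alpha)$ where $A$ is a $\mathbb{K}$-vector space, $\cdot$ is a bilinear binary operation on $A$, and $\alpha: A\to A$ is a linear map that is multiplicative: $\alpha(x\cdot y)=\alpha(x)\cdot\alpha(y)$ for all $x,y\in A$. A (left) Hom-Leibniz algebra is a Hom-algebra $(A,\cdot,\alpha)$ such that $\alpha(x)\cdot(y\cdot z) = (x\cdot y)\cdot\alpha(z) + \alpha(y)\cdot(x\cdot z)$ for all $x,y,z\in A$. Let $\alpha^m$ be the $m$-fold composition of $\alpha$, with $\alpha^0=\mathrm{Id}$. The $n$th (right) Hom-power $x^n$ of $x\in A$ is defined inductively by $x^1=x$ and $x^n = x^{n-1}\cdot\alpha^{n-2}(x)$ for $n\ge 2$. The Hom-algebra $A$ is $n$th Hom-power associative if $x^n = \alpha^{n-i-1}(x^i)\cdot\alpha^{i-1}(x^{n-i})$ for all $x\in A$ and all $i\in\{1,\dots,n-1\}$; it is Hom-power associative if it is $n$th Hom-power associative for all $n\ge 2$. *)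

theory Defs
  imports Complex_Main
begin

locale hom_algebra = vector_space scale
  for scale :: "'k::field \<Rightarrow> 'a::ab_group_add \<Rightarrow> 'a" +
  fixes mult :: "'a \<Rightarrow> 'a \<Rightarrow> 'a"  (infixl "\<cdot>" 70)
    and \<alpha> :: "'a \<Rightarrow> 'a"
  assumes linear_mult_left: "\<And>y. Vector_Spaces.linear scale scale (\<lambda>x. x \<cdot> y)"
    and linear_mult_right: "\<And>x. Vector_Spaces.linear scale scale (\<lambda>y. x \<cdot> y)"
    and linear_twist: "Vector_Spaces.linear scale scale \<alpha>"
    and twist_mult: "\<And>x y. \<alpha> (x \<cdot> y) = \<alpha> x \<cdot> \<alpha> y"

locale hom_leibniz_algebra = hom_algebra scale mult \<alpha>
  for scale :: "'k::field \<Rightarrow> 'a::ab_group_add \<Rightarrow> 'a"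
    and mult :: "'a \<Rightarrow> 'a \<Rightarrow> 'a"  (infixl "\<cdot>" 70)
    and \<alpha> :: "'a \<Rightarrow> 'a" +
  assumes left_hom_leibniz:
    "\<And>x y z. \<alpha> x \<cdot> (y \<cdot> z) = (x \<cdot> y) \<cdot> \<alpha> z + \<alpha> y \<cdot> (x \<cdot> z)"

(* Right Hom-powers exist only for exponents n >= 1; the value at exponent 0 is a
   placeholder that none of the notions below refers to. *)
fun hom_power :: "('a \<Rightarrow> 'a \<Rightarrow> 'a) \<Rightarrow> ('a \<Rightarrow> 'a) \<Rightarrow> 'a \<Rightarrow> nat \<Rightarrow> 'a" where
  "hom_power mult \<alpha> x 0 = undefined"
| "hom_power mult \<alpha> x (Suc 0) = x"
| "hom_power mult \<alpha> x (Suc (Suc n)) = mult (hom_power mult \<alpha> x (Suc n)) ((\<alpha> ^^ n) x)"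

definition nth_hom_power_associative ::
    "('a \<Rightarrow> 'a \<Rightarrow> 'a) \<Rightarrow> ('a \<Rightarrow> 'a) \<Rightarrow> nat \<Rightarrow> bool" where
  "nth_hom_power_associative mult \<alpha> n \<longleftrightarrow>
    (\<forall>x. \<forall>i\<in>{1..n-1}. hom_power mult \<alpha> x n =
      mult ((\<alpha> ^^ (n - i - 1)) (hom_power mult \<alpha> x i))
           ((\<alpha> ^^ (i - 1)) (hom_power mult \<alpha> x (n - i))))"

definition hom_power_associative :: "('a \<Rightarrow> 'a \<Rightarrow> 'a) \<Rightarrow> ('a \<Rightarrow> 'a) \<Rightarrow> bool" where
  "hom_power_associative mult \<alpha> \<longleftrightarrow> (\<forall>n\<ge>2. nth_hom_power_associative mult \<alpha> n)"

end

theory Submission imports Defs begin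

text \<open>Putting y = x in the left Hom-Leibniz identity makes one term cancel and leaves (x x)
  \<alpha>(z) = 0: squares annihilate the image of \<alpha> from the left
  (\<open>square_mult_twist\<close>). Hence x^3 = x^2 \<alpha>(x) = 0, and every later power has a
  zero left factor. In the associativity condition with n = i + j, any i or j above 2 makes both
  sides vanish, so only i, j in {1, 2} matter. Of these, (1,1) is trivial, (2,1) and (2,2) follow
  from the annihilation law, and (1,2) says exactly that \<alpha>(x) x^2 = 0.\<close>

context hom_algebra
begin

lemma mult_zero_left [simp]: "0 \<cdot> y = 0"
  by (rule module_hom.zero[OF Vector_Spaces.linear.axioms(3)[OF linear_mult_left]])

lemma mult_zero_right [simp]: "x \<cdot> 0 = 0"
  by (rule module_hom.zero[OF Vector_Spaces.linear.axioms(3)[OF linear_mult_right]])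

lemma twist_zero [simp]: "\<alpha> 0 = 0"
  by (rule module_hom.zero[OF Vector_Spaces.linear.axioms(3)[OF linear_twist]])

lemma twist_funpow_zero [simp]: "(\<alpha> ^^ n) 0 = 0"
  by (induction n) auto

end

context hom_leibniz_algebra
begin

lemma square_mult_twist [simp]: "(x \<cdot> x) \<cdot> \<alpha> z = 0"
  using left_hom_leibniz[of x x z] by simp

lemma hom_power_eq_0: "hom_power (\<cdot>) \<alpha> x n = 0" if "n \<ge> 3"
  using that
proof (induction n rule: dec_induct)
  case base
  show ?case by (simp add: numeral_3_eq_3)
next
  case (step n)
  \<comment> \<open>The recursion for \<open>hom_power\<close> unfolds only at a double successor,
    so \<open>Suc n\<close> must be exposed as \<open>Suc (Suc m)\<close>.\<close>
  then obtain m where "n = Suc m" by (cases n) auto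
  with step.IH show ?case by simp
qed

lemma hom_power_associativeI:
  assumes "\<And>x. \<alpha> x \<cdot> (x \<cdot> x) = 0"
  shows "hom_power_associative (\<cdot>) \<alpha>"
  unfolding hom_power_associative_def nth_hom_power_associative_def
proof (intro allI impI ballI)
  fix n i :: nat and x
  assume n: "n \<ge> 2" and i: "i \<in> {1..n-1}"
  let ?p = "hom_power (\<cdot>) \<alpha> x"
  define j where "j = n - i"
  have n_eq: "n = i + j" and "i \<ge> 1" "j \<ge> 1"
    using n i by (auto simp: j_def)
  \<comment> \<open>A factor of exponent at least 3 is zero and stays zero under powers of \<alpha>;
    only four small pairs are left.\<close>
  then consider "i \<ge> 3" | "j \<ge> 3" | "i = 1" "j = 1" | "i = 1" "j = 2"
    | "i = 2" "j = 1" | "i = 2" "j = 2"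
    by linarith
  then have "?p (i + j) = (\<alpha> ^^ (j - 1)) (?p i) \<cdot> (\<alpha> ^^ (i - 1)) (?p j)"
  proof cases
    case 4
    then show ?thesis using assms by (simp add: numeral_2_eq_2)
  next
    case 6
    \<comment> \<open>Here the right side is \<alpha>(x^2) \<alpha>(x^2), where the left factor is
      the square of \<alpha>(x). The law is supplied as an explicit instance because
      \<open>twist_mult\<close> pushes \<alpha> inside the right factor, hiding the pattern of the
      simp rule.\<close>
    then show ?thesis
      using square_mult_twist[of "\<alpha> x" "x \<cdot> x"]
      by (simp add: hom_power_eq_0 numeral_2_eq_2 twist_mult)
  qed (simp_all add: hom_power_eq_0 numeral_2_eq_2)
  then show "?p n = (\<alpha> ^^ (n - i - 1)) (?p i) \<cdot> (\<alpha> ^^ (i - 1)) (?p (n - i))"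
    using n_eq by simp
qed

text \<open>The condition is read off from the single instance n = 3, i = 1, whose left side x^3 is
  already zero.\<close>

lemma hom_power_associativeD:
  assumes "hom_power_associative (\<cdot>) \<alpha>"
  shows "\<alpha> x \<cdot> (x \<cdot> x) = 0"
proof -
  have "nth_hom_power_associative (\<cdot>) \<alpha> 3"
    using assms by (simp add: hom_power_associative_def)
  \<comment> \<open>The differences are left unevaluated to match the definition at i = 1.\<close>
  then have "hom_power (\<cdot>) \<alpha> x 3 =
      (\<alpha> ^^ (3 - 1 - 1)) (hom_power (\<cdot>) \<alpha> x 1) \<cdot> (\<alpha> ^^ (1 - 1)) (hom_power (\<cdot>) \<alpha> x (3 - 1))"
    unfolding nth_hom_power_associative_def by (elim allE ballE) auto
  then show ?thesis
    by (simp add: hom_power_eq_0 numeral_2_eq_2)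
qed

end

theorem theorem3p7:
  fixes scale :: "'k::field_char_0 \<Rightarrow> 'a::ab_group_add \<Rightarrow> 'a"
    and mult :: "'a \<Rightarrow> 'a \<Rightarrow> 'a"
    and \<alpha> :: "'a \<Rightarrow> 'a"
  assumes "hom_leibniz_algebra scale mult \<alpha>"
  shows "(\<forall>n\<ge>3. \<forall>x. hom_power mult \<alpha> x n = 0) \<and>
    (hom_power_associative mult \<alpha> \<longleftrightarrow>
      (\<forall>x. mult (\<alpha> x) (hom_power mult \<alpha> x 2) = 0))"
proof -
  interpret hom_leibniz_algebra scale mult \<alpha> by (rule assms)
  have "hom_power mult \<alpha> x 2 = mult x x" for x
    by (simp add: numeral_2_eq_2)
  then show ?thesis
    using hom_power_eq_0 hom_power_associativeI hom_power_associativeD by auto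
qed

end
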